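(* Let $R$ be a noncommutative prime ring and let $n \geq 3$ be a positive integer. Then every nonzero $n$-generalized Lie ideal of $R$ contains a nonzero ideal of $R$.
   Context: Rings are associative, not necessarily with unity; "ideal" means two-sided ideal. A ring $R$ is prime if, for $a,b\in R$, $aRb=0$ implies $a=0$ or $b=0$. For $a_1,\ldots,a_n\in R$ put $[a_1,\ldots,a_n]_n := a_1a_2\cdots a_n - a_na_{n-1}\cdots a_1$ (the $n$-generalized commutator). An $n$-generalized Lie ideal of $R$ (at the $(r+1)$-th position with $r\geq 0$) is an additive subgroup $A$ of $R$ satisfying $[x_1,\ldots,x_r,a,y_1,\ldots,y_s]_n\in A$ for all $x_i,y_j\in R$ and all $a\in A$, where $r,s\ge 0$ are fixed integers with $r+s=n-1$. An $n$-generalized Lie ideal means one at the $(r+1)$-th position for some such $r$. *)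

theory Defs
  imports Main
begin

text \<open>
  The type class \<open>ring\<close> is the class of associative rings, not necessarily commutative
  and not necessarily with unity.
\<close>

definition is_prime_ring :: "'a::ring itself \<Rightarrow> bool" where
  "is_prime_ring _ \<longleftrightarrow>
     (\<forall>a b :: 'a. (\<forall>x. a * x * b = 0) \<longrightarrow> a = 0 \<or> b = 0)"

text \<open>
  Product of a nonempty list. In the absence of a unity there is no empty product; the value
  at the empty list is a dummy, and the generalized commutator below is only ever applied to
  lists of length at least one.
\<close>

fun list_product :: "'a::ring list \<Rightarrow> 'a" where
  "list_product [] = 0"
| "list_product [x] = x"
| "list_product (x # y # zs) = x * list_product (y # zs)"

definition gen_commutator :: "'a::ring list \<Rightarrow> 'a" where
  "gen_commutator as = list_product as - list_product (rev as)"

definition additive_subgroup_of_ring :: "'a::ring set \<Rightarrow> bool" where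
  "additive_subgroup_of_ring A \<longleftrightarrow>
     0 \<in> A \<and> (\<forall>a\<in>A. \<forall>b\<in>A. a + b \<in> A) \<and> (\<forall>a\<in>A. - a \<in> A)"

definition two_sided_ideal :: "'a::ring set \<Rightarrow> bool" where
  "two_sided_ideal I \<longleftrightarrow>
     additive_subgroup_of_ring I \<and> (\<forall>x. \<forall>a\<in>I. x * a \<in> I \<and> a * x \<in> I)"

text \<open>The distinguished entry is preceded by \<open>r\<close> and followed by \<open>s\<close> ring elements.\<close>

definition gen_Lie_ideal_at :: "nat \<Rightarrow> nat \<Rightarrow> 'a::ring set \<Rightarrow> bool" where
  "gen_Lie_ideal_at r s A \<longleftrightarrow>
     additive_subgroup_of_ring A \<and>
     (\<forall>xs ys. \<forall>a\<in>A. length xs = r \<longrightarrow> length ys = s \<longrightarrow>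
        gen_commutator (xs @ [a] @ ys) \<in> A)"

definition gen_Lie_ideal :: "nat \<Rightarrow> 'a::ring set \<Rightarrow> bool" where
  "gen_Lie_ideal n A \<longleftrightarrow> (\<exists>r s. r + s + 1 = n \<and> gen_Lie_ideal_at r s A)"

end

theory Submission
  imports Defs
begin

text \<open>
  Reversing the word of a generalized commutator changes only its sign, so a generalized Lie
  ideal \<open>A\<close> with \<open>r\<close> entries before the distinguished one and \<open>s\<close> after it has the same
  property with \<open>r\<close> and \<open>s\<close> exchanged. Since \<open>r + s \<ge> 2\<close>, either \<open>s \<ge> 2\<close> may be assumed or
  \<open>r = s = 1\<close>. In both cases the aim is a single \<open>e \<noteq> 0\<close> with \<open>R e R \<subseteq> A\<close>; then \<open>A\<close>
  contains the nonzero ideal generated by the elements \<open>x e y\<close>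
  (\<open>nonzero_ideal_of_sandwiched\<close>).

  Let \<open>s \<ge> 2\<close>. A factor \<open>w\<close> between the first two entries after \<open>a\<close> can be absorbed into
  either of them. The forward product does not see the difference, but the reversed one does:
  subtracting the two generalized commutators shows that
  \<open>y\<^sub>s \<dots> y\<^sub>3 [w, y\<^sub>2 y\<^sub>1] a x\<^sub>r \<dots> x\<^sub>1\<close> lies in \<open>A\<close> (\<open>commutator_left_multiplier\<close>). Such left
  multipliers can be composed at the cost of longer right factors. If \<open>s > 2\<close>, the free leading
  factor makes them a left ideal; if \<open>s = 2\<close>, the identity \<open>x [v, g] = [x v, g] - [x, g] v\<close>
  with \<open>g \<in> R\<^sup>2\<close> produces one. So \<open>x d a z\<^sub>1 \<dots> z\<^sub>k \<in> A\<close> for all \<open>x\<close> and \<open>z\<^sub>i\<close>, and primeness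
  and noncommutativity allow \<open>d a \<noteq> 0\<close> (\<open>exists_left_multiplier_left_ideal\<close>). For \<open>k > 0\<close>
  this yields \<open>e\<close>; for \<open>k = 0\<close>, which occurs only if \<open>r = 0\<close>, the missing factors on the right come
  from the defining condition on \<open>A\<close> (\<open>exists_ideal_of_far_position\<close>).

  Let \<open>r = s = 1\<close>. In the ring \<open>M\<close> of operators \<open>a \<mapsto> \<Sum> p\<^sub>i a q\<^sub>i\<close>, think of \<open>R \<otimes> R\<^sup>o\<^sup>p\<close> with
  the involution \<open>(p \<otimes> q)\<^sup>* = q \<otimes> p\<close>; the operators \<open>a \<mapsto> x a y - y a x\<close>, which preserve \<open>A\<close>,
  span the elements \<open>t - t\<^sup>*\<close>. Write \<open>K\<close> for this span. As in Herstein's theory of skew elements,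
  \<open>k m + m\<^sup>* k \<in> K\<close> for \<open>k \<in> K\<close> and \<open>m \<in> M\<close>, whence \<open>[K K, M]\<close> preserves \<open>A\<close>, and so does
  \<open>M [K K, K]\<close> (\<open>sandwiched_skew_commutator\<close>). It remains to see that \<open>[K K, K]\<close> does not
  annihilate a nonzero \<open>a \<in> A\<close>. This vanishing is a generalized polynomial identity, and
  substituting twice in one variable eliminates four of its six terms. The two that survive
  force \<open>K a = 0\<close>, and then \<open>a = 0\<close> (\<open>skew_commutators_trivial_imp_skew_0\<close>,
  \<open>skew_trivial_imp_0\<close>).
\<close>

abbreviation lie :: "'a::ring \<Rightarrow> 'a \<Rightarrow> 'a" where
  "lie x y \<equiv> x * y - y * x"

section \<open>List products\<close>

lemma list_product_Cons: "xs \<noteq> [] \<Longrightarrow> list_product (x # xs) = x * list_product xs"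
  by (cases xs) auto

lemma list_product_append:
  "xs \<noteq> [] \<Longrightarrow> ys \<noteq> [] \<Longrightarrow> list_product (xs @ ys) = list_product xs * list_product ys"
proof (induction xs)
  case (Cons x xs)
  then show ?case
    by (cases xs) (simp_all add: list_product_Cons mult.assoc)
qed simp

lemma list_product_merge_suffix:
  "ys \<noteq> [] \<Longrightarrow> list_product (xs @ ys) = list_product (xs @ [list_product ys])"
  by (cases xs) (simp_all add: list_product_append flip: append_Cons)

lemma list_product_snoc_mult: "list_product (zs @ [x * y]) = list_product (zs @ [x]) * y"
  by (cases "zs = []") (simp_all add: list_product_append mult.assoc)

lemma list_product_snoc_diff:
  "list_product (zs @ [x]) - list_product (zs @ [y]) = list_product (zs @ [x - y])"
  by (cases "zs = []") (simp_all add: list_product_append algebra_simps)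

lemma mult_list_product_Cons: "x * list_product (y # zs) = list_product (x * y # zs)"
  by (cases "zs = []") (simp_all add: list_product_Cons mult.assoc)

lemma list_product_list_product_Cons:
  "xs \<noteq> [] \<Longrightarrow> list_product (list_product xs # vs) = list_product (xs @ vs)"
  by (cases "vs = []") (simp_all add: list_product_Cons list_product_append)

lemma list_product_shift_factor:
  "list_product (us @ (x * w) # y # vs) = list_product (us @ x # (w * y) # vs)"
  by (cases "us = []"; cases "vs = []")
     (simp_all add: list_product_append list_product_Cons mult.assoc)

section \<open>Additive subgroups and generalized Lie ideals\<close>

lemma additive_subgroupD:
  assumes "additive_subgroup_of_ring A"
  shows "0 \<in> A" "a \<in> A \<Longrightarrow> b \<in> A \<Longrightarrow> a + b \<in> A" "a \<in> A \<Longrightarrow> - a \<in> A"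
    "a \<in> A \<Longrightarrow> b \<in> A \<Longrightarrow> a - b \<in> A"
proof -
  show "0 \<in> A" and plus: "a \<in> A \<Longrightarrow> b \<in> A \<Longrightarrow> a + b \<in> A" and minus: "a \<in> A \<Longrightarrow> - a \<in> A"
    for a b using assms by (auto simp: additive_subgroup_of_ring_def)
  show "a - b \<in> A" if "a \<in> A" "b \<in> A"
    using plus[OF that(1) minus[OF that(2)]] by simp
qed

lemma gen_Lie_ideal_atD:
  assumes "gen_Lie_ideal_at r s A"
  shows "additive_subgroup_of_ring A"
    "a \<in> A \<Longrightarrow> length xs = r \<Longrightarrow> length ys = s \<Longrightarrow> gen_commutator (xs @ [a] @ ys) \<in> A"
  using assms by (simp_all add: gen_Lie_ideal_at_def)

section \<open>Noncommutative prime rings\<close>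

context
  fixes ty :: "'a::ring itself"
  assumes prime: "is_prime_ring TYPE('a)"
begin

lemma primeD: "(\<And>x. a * x * b = 0) \<Longrightarrow> a = 0 \<or> b = (0::'a)"
  using prime by (auto simp: is_prime_ring_def)

lemma left_annihilator_trivial: "(\<And>x::'a. x * b = 0) \<Longrightarrow> b = 0"
  using primeD[of b b] by simp

lemma right_annihilator_trivial: "(\<And>x::'a. b * x = 0) \<Longrightarrow> b = 0"
  using primeD[of b b] by simp

lemma exists_list_product_Cons_neq_0:
  "b \<noteq> (0::'a) \<Longrightarrow> \<exists>zs. length zs = m \<and> list_product (b # zs) \<noteq> 0"
proof (induction m)
  case (Suc m)
  then obtain zs where zs: "length zs = m" "list_product (b # zs) \<noteq> 0" by auto
  then obtain x where "list_product (b # zs) * x \<noteq> 0"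
    using right_annihilator_trivial by blast
  then have "list_product (b # zs @ [x]) \<noteq> 0"
    using list_product_append[of "b # zs" "[x]"] by simp
  then show ?case using zs by (intro exI[of _ "zs @ [x]"]) simp
qed simp

lemma exists_list_product_snoc_neq_0:
  "b \<noteq> (0::'a) \<Longrightarrow> \<exists>zs. length zs = m \<and> list_product (zs @ [b]) \<noteq> 0"
proof (induction m)
  case (Suc m)
  then obtain zs where zs: "length zs = m" "list_product (zs @ [b]) \<noteq> 0" by auto
  then obtain x where "x * list_product (zs @ [b]) \<noteq> 0"
    using left_annihilator_trivial by blast
  then show ?case using zs
    by (intro exI[of _ "x # zs"]) (simp add: list_product_Cons)
qed simp

text \<open>
  Without a unity, describing the generated ideal by finite sums is awkward. The largest ideal
  contained in \<open>A\<close> serves the same purpose; it contains every \<open>x e y\<close>, and these products do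
  not all vanish.
\<close>
lemma nonzero_ideal_of_sandwiched:
  assumes A: "additive_subgroup_of_ring A" and "e \<noteq> (0::'a)" and e: "\<And>x y. x * e * y \<in> A"
  shows "\<exists>I. two_sided_ideal I \<and> I \<noteq> {0} \<and> I \<subseteq> A"
proof -
  note sub = additive_subgroupD[OF A]
  define I where "I = {z \<in> A. \<forall>x y. x * z \<in> A \<and> z * x \<in> A \<and> x * z * y \<in> A}"
  have "x * (a + b) * y = x * a * y + x * b * y" for x y a b :: 'a
    by (simp add: algebra_simps)
  then have "two_sided_ideal I"
    using sub
    by (auto simp: two_sided_ideal_def additive_subgroup_of_ring_def I_def
        distrib_left distrib_right simp flip: mult.assoc)
       (metis mult.assoc)+
  moreover have "x * e * y \<in> I" for x y
    using e e[of _ "y * _"] e[of "_ * x"] e[of "_ * x" "y * _"]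
    by (simp add: I_def mult.assoc)
  moreover have "\<exists>x y. x * e * y \<noteq> 0"
    using \<open>e \<noteq> 0\<close> left_annihilator_trivial right_annihilator_trivial by metis
  ultimately show ?thesis
    by (intro exI[of _ I]) (auto simp: I_def)
qed

text \<open>
  The inner derivation \<open>\<delta> t = [t, w]\<close> is assumed to satisfy \<open>\<delta> t \<cdot> t = 0\<close>. Linearizing gives
  \<open>\<delta> t \<cdot> r + \<delta> r \<cdot> t = 0\<close>, and replacing \<open>t\<close> by products yields \<open>\<delta> s \<cdot> t \<cdot> [z, r] = 0\<close>.
\<close>
lemma derivation_annihilating_argument_trivial:
  assumes noncomm: "\<exists>x y::'a. lie x y \<noteq> 0"
    and "\<And>t::'a. lie t w * t = 0"
  shows "lie t w = 0"
proof -
  have lin: "lie t w * r + lie r w * t = 0" for t r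
    using assms(2)[of "t + r"] assms(2)[of t] assms(2)[of r]
    by (simp add: algebra_simps)
  have h: "lie t w * lie z r + t * lie z w * r = 0" for t z r
  proof -
    have "lie t w * lie z r + t * lie z w * r
        = lie (t * z) w * r + lie r w * (t * z) - (lie t w * r + lie r w * t) * z"
      by (simp add: algebra_simps)
    then show ?thesis by (simp only: lin) simp
  qed
  have "lie s w * t * lie z r = 0" for s t z r
  proof -
    have "lie s w * t * lie z r = (lie (s * t) w * lie z r + (s * t) * lie z w * r)
        - s * (lie t w * lie z r + t * lie z w * r)"
      by (simp add: algebra_simps)
    then show ?thesis by (simp only: h) simp
  qed
  then show ?thesis using primeD noncomm by blast
qed

text \<open>
  Commuting is demanded only for products and only up to the fixed right factor \<open>a\<close>, because
  the theorem needs commutators that do not annihilate a given element of the generalized Lie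
  ideal. The Leibniz rule for \<open>[x z y, v]\<close> isolates \<open>[x, v] z y a\<close>.
\<close>
lemma central_if_commutes_with_products:
  assumes "a \<noteq> (0::'a)" and "\<And>z y. lie (z * y) v * a = 0"
  shows "lie x v = 0"
proof -
  have "lie x v * z * (y * a) = 0" for z y
  proof -
    have "lie x v * z * (y * a) = lie (x * z * y) v * a - x * (lie (z * y) v * a)"
      by (simp add: algebra_simps)
    then show ?thesis using assms(2)[of "x * z" y] assms(2)[of z y] by simp
  qed
  then show ?thesis
    using primeD[of "lie x v"] left_annihilator_trivial[of a] \<open>a \<noteq> 0\<close> by blast
qed

lemma exists_commutator_with_product:
  assumes noncomm: "\<exists>x y::'a. lie x y \<noteq> 0" and "a \<noteq> (0::'a)"
  shows "\<exists>w z y. lie w (z * y) * a \<noteq> 0"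
proof (rule ccontr)
  assume "\<not> ?thesis"
  then have "lie (z * y) w * a = 0" for w z y
    by (metis minus_diff_eq mult_minus_left neg_0_equal_iff_equal)
  then show False using central_if_commutes_with_products[OF \<open>a \<noteq> 0\<close>] noncomm by blast
qed

text \<open>
  Otherwise all \<open>v = [w, z y]\<close> are central. Since \<open>w v = [w, w z y]\<close> is of the same form, it is
  central as well, so \<open>[t, w] v = 0\<close>. As \<open>v\<close> is central, primeness gives \<open>v = 0\<close> or \<open>w\<close> central,
  hence always \<open>[w, z y] = 0\<close>, which is impossible in a noncommutative prime ring.
\<close>
lemma exists_double_commutator_with_products:
  assumes noncomm: "\<exists>x y::'a. lie x y \<noteq> 0" and "a \<noteq> (0::'a)"
  shows "\<exists>z y w z' y'. lie (z * y) (lie w (z' * y')) * a \<noteq> 0"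
proof (rule ccontr)
  assume "\<not> ?thesis"
  then have zero: "lie (z' * y') (lie w (z * y)) * a = 0" for z' y' w z y
    by blast
  have central: "lie x (lie w (z * y)) = 0" for x w z y :: 'a
    by (rule central_if_commutes_with_products[OF \<open>a \<noteq> 0\<close>]) (rule zero)
  have "lie w (z * y) = 0" for w z y :: 'a
  proof (rule ccontr)
    let ?v = "lie w (z * y)"
    assume nz: "?v \<noteq> 0"
    have "lie t w * x * ?v = 0" for t x
    proof -
      have "lie t w * x * ?v = lie t (lie w (w * z * y)) * x - w * lie t ?v * x + lie t w * lie x ?v"
        by (simp add: algebra_simps)
      then show ?thesis using central[of t w "w * z" y] central by simp
    qed
    then have "lie t w = 0" for t using primeD[of "lie t w" ?v] nz by blast
    from this[of "z * y"] nz show False by simp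
  qed
  then show False using exists_commutator_with_product[OF noncomm \<open>a \<noteq> 0\<close>] by simp
qed


end

section \<open>Left multipliers of a generalized Lie ideal\<close>

text \<open>
  The right factors are kept in one list with \<open>a\<close> so that the case \<open>k = 0\<close>, in which nothing
  stands to the right of \<open>a\<close>, needs no unity.
\<close>
definition left_multiplier :: "'a::ring set \<Rightarrow> nat \<Rightarrow> 'a \<Rightarrow> bool" where
  "left_multiplier A k t \<longleftrightarrow>
     (\<forall>a\<in>A. \<forall>zs. length zs = k \<longrightarrow> t * list_product (a # zs) \<in> A)"

lemma left_multiplierD:
  "left_multiplier A k t \<Longrightarrow> a \<in> A \<Longrightarrow> length zs = k \<Longrightarrow> t * list_product (a # zs) \<in> A"
  by (simp add: left_multiplier_def)

lemma left_multiplier_diff: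
  "additive_subgroup_of_ring A \<Longrightarrow> left_multiplier A k t \<Longrightarrow> left_multiplier A k u
    \<Longrightarrow> left_multiplier A k (t - u)"
  by (simp add: left_multiplier_def left_diff_distrib additive_subgroupD)

lemma left_multiplier_mult:
  fixes A :: "'a::ring set"
  assumes t: "left_multiplier A k t" and u: "left_multiplier A l u"
  shows "left_multiplier A (l + k) (t * u)"
  unfolding left_multiplier_def
proof (intro ballI allI impI)
  fix a and zs :: "'a list" assume a: "a \<in> A" and len: "length zs = l + k"
  define us vs where "us = take l zs" and "vs = drop l zs"
  have zs: "zs = us @ vs" and us: "length us = l" and vs: "length vs = k"
    using len by (simp_all add: us_def vs_def)
  have "t * list_product (u * list_product (a # us) # vs) \<in> A"
    by (intro left_multiplierD[OF t] left_multiplierD[OF u] a us vs)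
  also have "t * list_product (u * list_product (a # us) # vs) = t * u * list_product (a # zs)"
    by (simp add: zs list_product_list_product_Cons mult.assoc flip: mult_list_product_Cons)
  finally show "t * u * list_product (a # zs) \<in> A" .
qed

text \<open>
  This brings a single multiplier to the same number of right factors as a product of two of
  them, so that they can be subtracted: for \<open>k > 0\<close> the
  surplus right factors are absorbed into the last one.
\<close>
lemma left_multiplier_double:
  fixes A :: "'a::ring set"
  assumes t: "left_multiplier A k t"
  shows "left_multiplier A (k + k) t"
proof (cases k)
  case (Suc j)
  show ?thesis
    unfolding left_multiplier_def
  proof (intro ballI allI impI)
    fix a and zs :: "'a list" assume a: "a \<in> A" and len: "length zs = k + k"
    have "list_product (a # zs) = list_product (a # take j zs @ [list_product (drop j zs)])"
      using list_product_merge_suffix[of "drop j zs" "a # take j zs"] len Suc by simp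
    then show "t * list_product (a # zs) \<in> A"
      using left_multiplierD[OF t a, of "take j zs @ [list_product (drop j zs)]"] len Suc by simp
  qed
qed (use t in simp)

text \<open>
  With \<open>w\<close> absorbed into either of the neighbouring entries \<open>y\<close> and \<open>z\<close>, the words
  \<open>\<dots> a (y w) z \<dots>\<close> and \<open>\<dots> a y (w z) \<dots>\<close> have equal products, while their reversals contain
  \<open>z (y w) a\<close> and \<open>(w z) y a\<close>. The difference of the two generalized commutators is therefore a
  multiple of \<open>[w, z y] a\<close>.
\<close>
lemma commutator_left_multiplier:
  fixes A :: "'a::ring set"
  assumes gli: "gen_Lie_ideal_at r s A" and s: "s = length zs + 2"
  shows "left_multiplier A r (list_product (zs @ [lie w (z * y)]))"
  unfolding left_multiplier_def
proof (intro ballI allI impI)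
  fix a and xs :: "'a list" assume a: "a \<in> A" and xs: "length xs = r"
  note sub = additive_subgroupD[of A]
  have A: "additive_subgroup_of_ring A" by (rule gen_Lie_ideal_atD(1)[OF gli])
  have gc: "gen_commutator (rev xs @ [a] @ ys) \<in> A" if "length ys = s" for ys
    by (rule gen_Lie_ideal_atD(2)[OF gli a]) (simp_all add: xs that)
  let ?l = "gen_commutator (rev xs @ [a] @ [y * w, z] @ rev zs)"
  let ?r = "gen_commutator (rev xs @ [a] @ [y, w * z] @ rev zs)"
  have "?l - ?r \<in> A" using A s by (intro sub(4) gc) auto
  also have "?l - ?r = list_product ((zs @ [w * z, y]) @ (a # xs))
      - list_product ((zs @ [z, y * w]) @ (a # xs))"
    using list_product_shift_factor[of "rev xs @ [a]" y w z "rev zs"]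
    by (simp add: gen_commutator_def)
  also have "\<dots> = (list_product (zs @ [w * z, y]) - list_product (zs @ [z, y * w]))
      * list_product (a # xs)"
    by (subst (1 2) list_product_append) (simp_all add: left_diff_distrib)
  also have "list_product (zs @ [w * z, y]) - list_product (zs @ [z, y * w])
      = list_product (zs @ [lie w (z * y)])"
    by (subst (1 2) list_product_merge_suffix)
       (simp_all add: list_product_snoc_diff mult.assoc)
  finally show "list_product (zs @ [lie w (z * y)]) * list_product (a # xs) \<in> A" .
qed

context
  fixes ty :: "'a::ring itself"
  assumes prime: "is_prime_ring TYPE('a)"
begin

text \<open>
  The elements \<open>R d\<close> are left multipliers that do not annihilate \<open>a\<close>. The proviso on \<open>k\<close> records
  that \<open>k\<close> is \<open>r\<close> or \<open>2 r\<close>: if no right factor is available at all, the distinguished entry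
  stands first.
\<close>
lemma exists_left_multiplier_left_ideal:
  assumes noncomm: "\<exists>x y::'a. lie x y \<noteq> 0" and "a \<noteq> (0::'a)"
    and gli: "gen_Lie_ideal_at r s A" and "s \<ge> 2"
  shows "\<exists>d k. (k = 0 \<longrightarrow> r = 0) \<and> d * a \<noteq> 0 \<and> (\<forall>x. left_multiplier A k (x * d))"
proof (cases "s = 2")
  case True
  have mult: "left_multiplier A r (lie w (z * y))" for w z y
    using commutator_left_multiplier[OF gli, of "[]" w z y] True by simp
  have A: "additive_subgroup_of_ring A" by (rule gen_Lie_ideal_atD(1)[OF gli])
  obtain z y w z' y' where nz: "lie (z * y) (lie w (z' * y')) * a \<noteq> 0"
    using exists_double_commutator_with_products[OF prime noncomm \<open>a \<noteq> 0\<close>] by blast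
  define v where "v = lie w (z' * y')"
  have v: "left_multiplier A r v" unfolding v_def by (rule mult)
  have "left_multiplier A (r + r) (x * lie v (z * y))" for x
  proof -
    \<comment> \<open>Both commutators on the right of \<open>x [v, g] = [x v, g] - [x, g] v\<close>, with \<open>g = z y\<close>, are multipliers.\<close>
    have "left_multiplier A (r + r) (lie (x * v) (z * y) - lie x (z * y) * v)"
      by (rule left_multiplier_diff[OF A left_multiplier_double[OF mult]
            left_multiplier_mult[OF mult v]])
    then show ?thesis by (simp add: algebra_simps)
  qed
  moreover have "lie v (z * y) * a \<noteq> 0"
    using nz unfolding v_def[symmetric] by (simp add: left_diff_distrib)
  ultimately show ?thesis by (intro exI[of _ "lie v (z * y)"] exI[of _ "r + r"]) simp
next
  case False
  obtain w z y where "lie w (z * y) * a \<noteq> 0"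
    using exists_commutator_with_product[OF prime noncomm \<open>a \<noteq> 0\<close>] by blast
  then obtain zs where zs: "length zs = s - 3" "list_product (zs @ [lie w (z * y) * a]) \<noteq> 0"
    using exists_list_product_snoc_neq_0[OF prime] by blast
  let ?d = "list_product (zs @ [lie w (z * y)])"
  have "left_multiplier A r (x * ?d)" for x
    using commutator_left_multiplier[OF gli, of "x # zs" w z y] zs(1) False \<open>s \<ge> 2\<close>
    by (simp add: list_product_Cons)
  moreover have "?d * a \<noteq> 0" using zs(2) by (simp only: list_product_snoc_mult) simp
  ultimately show ?thesis by (intro exI[of _ ?d] exI[of _ r]) simp
qed

text \<open>
  Take \<open>e = d a z\<^sub>1 z\<^sub>2 \<dots>\<close> with one right factor missing, which is filled by the free \<open>y\<close> in
  \<open>x e y\<close>. If \<open>k = 0\<close>, multipliers give no right factors, but they put \<open>b = x d a\<close> and all its left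
  multiples into \<open>A\<close>. In \<open>b y\<^sub>1 \<dots> y\<^sub>s - y\<^sub>s \<dots> y\<^sub>1 b \<in> A\<close> the second term then lies in \<open>A\<close>, hence
  so does the first.
\<close>
lemma exists_ideal_of_far_position:
  assumes noncomm: "\<exists>x y::'a. lie x y \<noteq> 0" and a: "a \<in> A" "a \<noteq> (0::'a)"
    and gli: "gen_Lie_ideal_at r s A" and "s \<ge> 2"
  shows "\<exists>I. two_sided_ideal I \<and> I \<noteq> {0} \<and> I \<subseteq> A"
proof -
  have A: "additive_subgroup_of_ring A" by (rule gen_Lie_ideal_atD(1)[OF gli])
  obtain d k where k: "k = 0 \<longrightarrow> r = 0" and da: "d * a \<noteq> 0"
    and "\<forall>x. left_multiplier A k (x * d)"
    using exists_left_multiplier_left_ideal[OF noncomm a(2) gli \<open>s \<ge> 2\<close>] by (elim exE conjE)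
  then have d: "left_multiplier A k (x * d)" for x by simp
  obtain zs where zs: "length zs = (if k = 0 then s else k) - 1" "list_product (d * a # zs) \<noteq> 0"
    using exists_list_product_Cons_neq_0[OF prime da, of "(if k = 0 then s else k) - 1"]
    by (elim exE conjE)
  have split: "x * list_product (d * a # zs) * y = list_product (x * d * a # zs @ [y])" for x y
    using list_product_append[of "x * d * a # zs" "[y]"]
    by (simp add: mult_list_product_Cons mult.assoc)
  have "x * list_product (d * a # zs) * y \<in> A" for x y
  proof (cases "k = 0")
    case True
    have xda: "x * d * a \<in> A" for x using left_multiplierD[OF d a(1), of "[]" x] True by simp
    have "gen_commutator ([] @ [x * d * a] @ zs @ [y]) \<in> A"
      by (rule gen_Lie_ideal_atD(2)[OF gli xda]) (use k zs(1) True \<open>s \<ge> 2\<close> in simp_all)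
    moreover have "list_product (rev (zs @ [y]) @ [x * d * a]) \<in> A"
      using xda[of "list_product (rev (zs @ [y])) * x"]
      by (subst list_product_append) (simp_all add: mult.assoc)
    ultimately have "gen_commutator ([] @ [x * d * a] @ zs @ [y])
        + list_product (rev (zs @ [y]) @ [x * d * a]) \<in> A"
      by (rule additive_subgroupD(2)[OF A])
    then show ?thesis by (simp add: split gen_commutator_def)
  next
    case False
    then show ?thesis
      using left_multiplierD[OF d a(1), of "zs @ [y]" x] zs(1)
      unfolding split by (simp add: mult_list_product_Cons)
  qed
  then show ?thesis by (rule nonzero_ideal_of_sandwiched[OF prime A zs(2)])
qed

end

section \<open>The middle position of a triple\<close>

text \<open>
  The operator \<open>x \<otimes> y - y \<otimes> x\<close> in \<open>R \<otimes> R\<^sup>o\<^sup>p\<close>, which is skew for the involution exchanging the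
  two tensor factors.
\<close>
definition skew :: "'a::ring \<Rightarrow> 'a \<Rightarrow> 'a \<Rightarrow> 'a" where
  "skew x y a = x * a * y - y * a * x"

lemma skew_diff: "skew x y (a - b) = skew x y a - skew x y b"
  by (simp add: skew_def algebra_simps)

text \<open>
  In operator form this is \<open>k m + m\<^sup>* k \<in> K\<close> for \<open>k = x \<otimes> y - y \<otimes> x\<close> and \<open>m = p \<otimes> q\<close>.
\<close>
lemma skew_two_sided_mult:
  "skew x y (p * a * q) + q * skew x y a * p = skew (x * p) (q * y) a + skew (q * x) (y * p) a"
  by (simp add: skew_def algebra_simps)

text \<open>
  For \<open>k, k' \<in> K\<close>, moving \<open>m\<close> to the left past both operators replaces it by \<open>- m\<^sup>*\<close> and then by
  \<open>m\<close> again, up to operators that preserve \<open>A\<close>; so \<open>[k k', m]\<close> preserves \<open>A\<close>.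
\<close>
lemma skew_skew_commute_two_sided_mult:
  assumes A: "additive_subgroup_of_ring A" and skew: "\<And>x y a. a \<in> A \<Longrightarrow> skew x y a \<in> A"
    and a: "a \<in> A"
  shows "skew x y (skew x' y' (p * a * q)) - p * skew x y (skew x' y' a) * q \<in> A"
proof -
  note sub = additive_subgroupD[OF A]
  have twist: "skew x y (p * a * q) + q * skew x y a * p \<in> A" if "a \<in> A" for x y a p q
    unfolding skew_two_sided_mult by (intro sub skew that)
  have "skew x y (skew x' y' (p * a * q)) - p * skew x y (skew x' y' a) * q
      = skew x y (skew x' y' (p * a * q) + q * skew x' y' a * p)
        - (skew x y (q * skew x' y' a * p) + p * skew x y (skew x' y' a) * q)"
    by (simp add: skew_def algebra_simps)
  also have "\<dots> \<in> A" by (intro sub(4) skew twist a)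
  finally show ?thesis .
qed

text \<open>
  With \<open>b \<in> K K\<close>, \<open>c \<in> K\<close> and \<open>m = p \<otimes> q\<close>, the identity \<open>m [b, c] = [b, m c] - [b, m] c\<close> shows
  that \<open>m [b, c]\<close> preserves \<open>A\<close>: by the previous lemma \<open>[b, m c]\<close> and \<open>[b, m]\<close> do, and \<open>c\<close> does by
  assumption.
\<close>
lemma sandwiched_skew_commutator:
  assumes A: "additive_subgroup_of_ring A" and skew: "\<And>x y a. a \<in> A \<Longrightarrow> skew x y a \<in> A"
    and a: "a \<in> A"
  shows "p * (skew x y (skew x' y' (skew x'' y'' a)) - skew x'' y'' (skew x y (skew x' y' a))) * q \<in> A"
proof -
  define b where "b z = skew x y (skew x' y' z)" for z
  have b_diff: "b (u - v) = b u - b v" for u v by (simp add: b_def skew_diff)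
  have b: "b (p * z * q) - p * b z * q \<in> A" if "z \<in> A" for p q z
    unfolding b_def by (rule skew_skew_commute_two_sided_mult[OF A skew that])
  have "p * (b (skew x'' y'' a) - skew x'' y'' (b a)) * q
    = ((b ((p * x'') * a * (y'' * q)) - (p * x'') * b a * (y'' * q))
        - (b ((p * y'') * a * (x'' * q)) - (p * y'') * b a * (x'' * q)))
      - (b (p * skew x'' y'' a * q) - p * b (skew x'' y'' a) * q)"
  proof -
    have "p * skew x'' y'' a * q = (p * x'') * a * (y'' * q) - (p * y'') * a * (x'' * q)"
      by (simp add: skew_def algebra_simps)
    then have "b (p * skew x'' y'' a * q) = b ((p * x'') * a * (y'' * q)) - b ((p * y'') * a * (x'' * q))"
      by (simp add: b_diff)
    then show ?thesis by (simp add: skew_def[of x'' y'' "b a"] algebra_simps)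
  qed
  also have "\<dots> \<in> A" by (intro additive_subgroupD(4)[OF A] b a skew)
  finally show ?thesis unfolding b_def .
qed

text \<open>
  The hypothesis is linear in \<open>x\<close> and has the form \<open>\<Sum> \<alpha>\<^sub>i x \<beta>\<^sub>i = 0\<close>. Passing to
  \<open>\<Sum> [\<alpha>\<^sub>i, t] x [t, \<beta>\<^sub>i] = 0\<close> deletes every term in which \<open>\<alpha>\<^sub>i\<close> or \<open>\<beta>\<^sub>i\<close> is \<open>t\<close> or
  absent. This disposes of both terms with \<open>P\<close> and of two of the four with \<open>S\<close>.
\<close>
lemma eliminate_skew_commutator:
  fixes P S t c :: "'a::ring"
  assumes "\<And>x. skew x y P = skew c t (skew x y S)"
  shows "t * lie (y * S) t * x * lie c t = lie c t * x * lie t (S * y) * t"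
proof -
  define E where "E x = skew x y P - skew c t (skew x y S)" for x
  have "E x = 0" for x by (simp add: E_def assms)
  \<comment> \<open>This combination turns each \<open>\<alpha>\<^sub>i x \<beta>\<^sub>i\<close> into \<open>[\<alpha>\<^sub>i, t] x [t, \<beta>\<^sub>i]\<close>.\<close>
  then have "E (t * x * t) - t * E (x * t) - E (t * x) * t + t * E x * t = 0" by simp
  then have "t * lie (y * S) t * x * lie c t - lie c t * x * lie t (S * y) * t = 0"
    by (simp add: E_def skew_def algebra_simps)
  then show ?thesis by simp
qed

context
  fixes ty :: "'a::ring itself"
  assumes prime: "is_prime_ring TYPE('a)"
begin

text \<open>
  Comparing \<open>x z a y = y a x z\<close> with \<open>(x a y) z = (y a x) z\<close> gives \<open>z a y = a y z\<close>, and substituting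
  \<open>y x\<close> for \<open>y\<close> yields \<open>a R [z, x] = 0\<close>.
\<close>
lemma skew_trivial_imp_0:
  assumes noncomm: "\<exists>x y::'a. lie x y \<noteq> 0" and skew: "\<And>x y. skew x y a = (0::'a)"
  shows "a = 0"
proof -
  note D = primeD[OF prime]
  have h: "z * a * y = a * y * z" for y z
  proof -
    have "x * (z * a * y - a * y * z) = 0" for x
    proof -
      have "x * (z * a * y - a * y * z) = skew (x * z) y a - skew x y a * z"
        by (simp add: skew_def algebra_simps)
      then show ?thesis by (simp add: skew)
    qed
    then show ?thesis using left_annihilator_trivial[OF prime] by fastforce
  qed
  have "a * y * lie z x = 0" for x y z
  proof -
    have "a * y * lie z x = (z * a * (y * x) - a * (y * x) * z) - (z * a * y - a * y * z) * x"
      by (simp add: algebra_simps)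
    then show ?thesis by (simp only: h) simp
  qed
  then show ?thesis using D noncomm by blast
qed

text \<open>
  The identity left by the elimination has the form \<open>p x [c, t] = [c, t] x q\<close> with
  \<open>q = [t, S y] t\<close>, for all \<open>x\<close> and \<open>c\<close>. Replacing \<open>c\<close> by \<open>c t\<close> and then by \<open>r c\<close> removes the
  commutator and leaves \<open>t x q = x q t\<close>, hence \<open>q = 0\<close> for noncentral \<open>t\<close>. So the derivation
  \<open>[\<cdot>, S y]\<close> multiplied by its argument vanishes, every \<open>S y\<close> is central, and \<open>S = 0\<close>.
\<close>
lemma skew_commutators_trivial_imp_skew_0:
  assumes noncomm: "\<exists>x y::'a. lie x y \<noteq> 0"
    and triv: "\<And>x y c t. skew x y (skew x' y' (skew c t a)) = skew c t (skew x y (skew x' y' (a::'a)))"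
  shows "skew x' y' a = 0"
proof -
  note D = primeD[OF prime]
  define S where "S = skew x' y' a"
  have elim: "t * lie (y * S) t * x * lie c t = lie c t * x * lie t (S * y) * t" for t y x c
    by (rule eliminate_skew_commutator[of y "skew x' y' (skew c t a)" c t S]) (simp add: triv S_def)
  have q0: "lie t (S * y) * t = 0" for t y
  proof (cases "\<exists>r. lie r t \<noteq> 0")
    case True
    define p q where "p = t * lie (y * S) t" and "q = lie t (S * y) * t"
    have pq: "p * x * lie c t = lie c t * x * q" for x c
      using elim[of t y x c] by (simp add: p_def q_def mult.assoc)
    have step: "lie c t * (t * x * q - x * q * t) = 0" for c x
    proof -
      have "lie c t * (t * x * q - x * q * t)
          = (lie (c * t) t * x * q - p * x * lie (c * t) t)
            - (lie c t * x * q - p * x * lie c t) * t"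
        by (simp add: algebra_simps)
      then show ?thesis by (simp add: pq)
    qed
    have "lie r t * c * (t * x * q - x * q * t) = 0" for r c x
    proof -
      have "lie r t * c * (t * x * q - x * q * t)
          = lie (r * c) t * (t * x * q - x * q * t) - r * (lie c t * (t * x * q - x * q * t))"
        by (simp add: algebra_simps)
      then show ?thesis by (simp only: step) simp
    qed
    then have "t * x * q - x * q * t = 0" for x using D True by blast
    then have tq: "t * x * q = x * q * t" for x by simp
    have "lie r t * x * q = 0" for r x
    proof -
      have "lie r t * x * q = r * (t * x * q - x * q * t) - (t * (r * x) * q - (r * x) * q * t)"
        by (simp add: algebra_simps)
      then show ?thesis by (simp only: tq) simp
    qed
    then show ?thesis using D True unfolding q_def by blast
  next
    case False
    then have "lie (S * y) t = 0" by blast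
    then show ?thesis by (simp add: algebra_simps)
  qed
  have comm: "lie t (S * y) = 0" for t y
    by (rule derivation_annihilating_argument_trivial[OF prime noncomm q0])
  have "S * y * lie r z = 0" for r y z
  proof -
    have "S * y * lie r z = lie r (S * y * z) - lie r (S * y) * z"
      by (simp add: algebra_simps)
    then show ?thesis using comm[of r "y * z"] comm[of r y] by (simp add: mult.assoc)
  qed
  then show ?thesis using D noncomm unfolding S_def by blast
qed

lemma exists_ideal_of_middle_position:
  assumes noncomm: "\<exists>x y::'a. lie x y \<noteq> 0" and a: "a \<in> A" "a \<noteq> (0::'a)"
    and gli: "gen_Lie_ideal_at 1 1 A"
  shows "\<exists>I. two_sided_ideal I \<and> I \<noteq> {0} \<and> I \<subseteq> A"
proof -
  have A: "additive_subgroup_of_ring A" by (rule gen_Lie_ideal_atD(1)[OF gli])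
  have skew: "skew x y b \<in> A" if "b \<in> A" for x y b
  proof -
    have "gen_commutator ([x] @ [b] @ [y]) \<in> A"
      by (rule gen_Lie_ideal_atD(2)[OF gli that]) simp_all
    then show ?thesis by (simp add: gen_commutator_def skew_def mult.assoc)
  qed
  obtain x' y' where "skew x' y' a \<noteq> 0" using skew_trivial_imp_0[OF noncomm] a(2) by blast
  then obtain x y c t where
    "skew x y (skew x' y' (skew c t a)) \<noteq> skew c t (skew x y (skew x' y' a))"
    using skew_commutators_trivial_imp_skew_0[OF noncomm] by blast
  then have "skew x y (skew x' y' (skew c t a)) - skew c t (skew x y (skew x' y' a)) \<noteq> 0" by simp
  then show ?thesis
    by (rule nonzero_ideal_of_sandwiched[OF prime A])
       (rule sandwiched_skew_commutator[OF A skew a(1)])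
qed

end

section \<open>Ideals in generalized Lie ideals\<close>

lemma gen_commutator_rev: "gen_commutator (rev xs) = - gen_commutator xs"
  by (simp add: gen_commutator_def)

lemma gen_Lie_ideal_at_mirror:
  fixes A :: "'a::ring set"
  assumes "gen_Lie_ideal_at r s A"
  shows "gen_Lie_ideal_at s r A"
  unfolding gen_Lie_ideal_at_def
proof (intro conjI allI ballI impI)
  show A: "additive_subgroup_of_ring A" by (rule gen_Lie_ideal_atD(1)[OF assms])
  fix xs ys :: "'a list" and a assume "a \<in> A" "length xs = s" "length ys = r"
  then have "gen_commutator (rev ys @ [a] @ rev xs) \<in> A"
    by (intro gen_Lie_ideal_atD(2)[OF assms]) simp_all
  then show "gen_commutator (xs @ [a] @ ys) \<in> A"
    using additive_subgroupD(3)[OF A] gen_commutator_rev[of "rev ys @ [a] @ rev xs"] by fastforce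
qed

theorem theorem5p1:
  fixes A :: "'a::ring set" and n :: nat
  assumes "is_prime_ring TYPE('a)"
    and "\<exists>x y :: 'a. x * y \<noteq> y * x"
    and "n \<ge> 3"
    and "gen_Lie_ideal n A"
    and "A \<noteq> {0}"
  shows "\<exists>I. two_sided_ideal I \<and> I \<noteq> {0} \<and> I \<subseteq> A"
proof -
  obtain r s where rs: "r + s + 1 = n" "gen_Lie_ideal_at r s A"
    using assms(4) by (auto simp: gen_Lie_ideal_def)
  then have "0 \<in> A" by (simp add: gen_Lie_ideal_at_def additive_subgroup_of_ring_def)
  with \<open>A \<noteq> {0}\<close> obtain a where a: "a \<in> A" "a \<noteq> 0" by blast
  have noncomm: "\<exists>x y::'a. lie x y \<noteq> 0" using assms(2) by simp
  consider "s \<ge> 2" | "r \<ge> 2" | "r = 1" "s = 1" using rs(1) \<open>n \<ge> 3\<close> by linarith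
  then show ?thesis
  proof cases
    case 1
    then show ?thesis by (rule exists_ideal_of_far_position[OF assms(1) noncomm a rs(2)])
  next
    case 2
    then show ?thesis
      by (rule exists_ideal_of_far_position[OF assms(1) noncomm a gen_Lie_ideal_at_mirror[OF rs(2)]])
  next
    case 3
    then show ?thesis
      using exists_ideal_of_middle_position[OF assms(1) noncomm a] rs(2) by simp
  qed
qed

end
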